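(* Let $F:[0,1]\to[0,1]$ be the limit of the normalized numbers of nonzero states of $T_a$ (defined in the context). Then: (i) $F$ is Riemann integrable. (ii) $\int_0^1 F(x)\,dx=1/9$.
   Context: A two-dimensional elementary cellular automaton is a map $T:\{0,1\}^{\mathbb{Z}^2}\to\{0,1\}^{\mathbb{Z}^2}$ such that $(Tx)_{i,j}$ is given by a fixed local rule $f:\{0,1\}^5\to\{0,1\}$ applied to the center $C=x_{i,j}$ and its four von Neumann neighbors $U=x_{i,j+1}$, $D=x_{i,j-1}$, $L=x_{i-1,j}$, $R=x_{i+1,j}$. It is symmetrical if $f$ is invariant under left-right and top-bottom reflections and under rotations by multiples of $90^\circ$ of the four neighbors. Call two neighbors opposite if they are $\{U,D\}$ or $\{L,R\}$, and adjacent otherwise. $T_a$ denotes any symmetrical two-dimensional elementary cellular automaton whose local rule satisfies the following. If $C=0$: output $0$ if no neighbor is $1$; output $1$ if exactly one neighbor is $1$; output $0$ if exactly two neighbors are $1$ and they are adjacent; output $1$ if exactly two neighbors are $1$ and they are opposite; output $1$ if all four neighbors are $1$; if exactly three neighbors are $1$ the output is arbitrary. If $C=1$: output $0$ if no neighbor is $1$; all other outputs are arbitrary. (The arbitrary values, chosen compatibly with the symmetry, do not affect the orbit considered.) The single site seed $x_o\in\{0,1\}^{\mathbb{Z}^2}$ has $(x_o)_{0,0}=1$ and all other entries $0$. Define $num_a(0)=0$ and, for $t\ge1$, $num_a(t)=\sum_{(i,j)\in\mathbb{Z}^2}(T_a^{t-1}x_o)_{i,j}$. Binary expansions: $x\in[0,1]$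 is written $x=\sum_{i=0}^{\infty}x_i2^{-i}$, $x_i\in\{0,1\}$, using the finite expansion whenever there are two (so $x_0=1$ only for $x=1$). For $k>0$ and $x=t/2^k$ with $t$ an integer, $0\le t\le 2^k$, put $F_k(x)=num_a(t)/num_a(2^k)$. For $x\in[0,1]$ with truncations $x|_k=\sum_{i=0}^{k}x_i2^{-i}$, $F(x)=\lim_{k\to\infty}F_k(x|_k)$ (the limit exists). *)

theory Defs
  imports "HOL-Analysis.Analysis" "HOL-Library.Groups_Big_Fun"
begin

section \<open>Two-dimensional elementary cellular automata\<close>

text \<open>States are booleans (\<^term>\<open>True\<close> is the state 1). The arguments of a local rule are,
  in this order, center, up, down, left, right.\<close>

type_synonym config = "int \<times> int \<Rightarrow> bool"
type_synonym local_rule = "bool \<Rightarrow> bool \<Rightarrow> bool \<Rightarrow> bool \<Rightarrow> bool \<Rightarrow> bool"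

definition eca :: "local_rule \<Rightarrow> config \<Rightarrow> config" where
  "eca f x = (\<lambda>(i, j). f (x (i, j)) (x (i, j + 1)) (x (i, j - 1)) (x (i - 1, j)) (x (i + 1, j)))"

text \<open>The three equations are the left-right reflection, the top-bottom reflection and the
  rotation by 90 degrees; the other rotations are iterates of the last one.\<close>

definition symmetrical :: "local_rule \<Rightarrow> bool" where
  "symmetrical f \<longleftrightarrow> (\<forall>c u d l r.
     f c u d r l = f c u d l r \<and>
     f c d u l r = f c u d l r \<and>
     f c r l u d = f c u d l r)"

definition ones :: "bool \<Rightarrow> bool \<Rightarrow> bool \<Rightarrow> bool \<Rightarrow> nat" where
  "ones u d l r = of_bool u + of_bool d + of_bool l + of_bool r"

text \<open>An opposite pair of neighbors in state 1. Two neighbors that are not opposite are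
  adjacent.\<close>

definition opposite_ones :: "bool \<Rightarrow> bool \<Rightarrow> bool \<Rightarrow> bool \<Rightarrow> bool" where
  "opposite_ones u d l r \<longleftrightarrow> (u \<and> d) \<or> (l \<and> r)"

definition rule_a :: "local_rule \<Rightarrow> bool" where
  "rule_a f \<longleftrightarrow> (\<forall>u d l r.
     (ones u d l r = 0 \<longrightarrow> f False u d l r = False) \<and>
     (ones u d l r = 1 \<longrightarrow> f False u d l r = True) \<and>
     (ones u d l r = 2 \<and> \<not> opposite_ones u d l r \<longrightarrow> f False u d l r = False) \<and>
     (ones u d l r = 2 \<and> opposite_ones u d l r \<longrightarrow> f False u d l r = True) \<and>
     (ones u d l r = 4 \<longrightarrow> f False u d l r = True) \<and>
     (ones u d l r = 0 \<longrightarrow> f True u d l r = False))"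

definition single_site_seed :: config where
  "single_site_seed = (\<lambda>p. p = (0, 0))"

definition num :: "local_rule \<Rightarrow> nat \<Rightarrow> nat" where
  "num f t = (if t = 0 then 0
     else Sum_any (\<lambda>p. of_bool (((eca f ^^ (t - 1)) single_site_seed) p)))"

section \<open>Binary expansions and the limit function\<close>

definition is_binary_expansion :: "real \<Rightarrow> (nat \<Rightarrow> nat) \<Rightarrow> bool" where
  "is_binary_expansion x b \<longleftrightarrow> (\<forall>i. b i \<in> {0, 1}) \<and> (\<lambda>i. real (b i) / 2 ^ i) sums x"

definition binary_digits :: "real \<Rightarrow> nat \<Rightarrow> nat" where
  "binary_digits x = (THE b. is_binary_expansion x b \<and>
     ((\<exists>b'. is_binary_expansion x b' \<and> finite {i. b' i \<noteq> 0}) \<longrightarrow> finite {i. b i \<noteq> 0}))"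

definition binary_truncation :: "real \<Rightarrow> nat \<Rightarrow> real" where
  "binary_truncation x k = (\<Sum>i\<le>k. real (binary_digits x i) / 2 ^ i)"

text \<open>Only arguments of the form \<open>x = t / 2 ^ k\<close> with \<open>t\<close> a natural number are meaningful
  (and used below); for these the floor is just \<open>t\<close>.\<close>

definition normalized_num :: "local_rule \<Rightarrow> nat \<Rightarrow> real \<Rightarrow> real" where
  "normalized_num f k x = real (num f (nat \<lfloor>x * 2 ^ k\<rfloor>)) / real (num f (2 ^ k))"

definition limit_function :: "local_rule \<Rightarrow> real \<Rightarrow> real" where
  "limit_function f x = lim (\<lambda>k. normalized_num f k (binary_truncation x k))"

section \<open>The Riemann integral\<close>

text \<open>The library integral over \<open>{a..b}\<close> is the gauge integral. The Riemann integral only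
  allows constant gauges, that is, it bounds the mesh of the tagged partitions uniformly.\<close>

definition has_riemann_integral :: "(real \<Rightarrow> real) \<Rightarrow> real \<Rightarrow> real \<Rightarrow> real \<Rightarrow> bool" where
  "has_riemann_integral g a b I \<longleftrightarrow> (\<forall>e>0. \<exists>d>0. \<forall>p.
     p tagged_division_of {a..b} \<and> (\<forall>(x, K)\<in>p. diameter K < d) \<longrightarrow>
     \<bar>(\<Sum>(x, K)\<in>p. measure lborel K * g x) - I\<bar> < e)"

definition riemann_integrable :: "(real \<Rightarrow> real) \<Rightarrow> real \<Rightarrow> real \<Rightarrow> bool" where
  "riemann_integrable g a b \<longleftrightarrow> (\<exists>I. has_riemann_integral g a b I)"

definition riemann_integral :: "(real \<Rightarrow> real) \<Rightarrow> real \<Rightarrow> real \<Rightarrow> real" where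
  "riemann_integral g a b = (THE I. has_riemann_integral g a b I)"

lemma has_riemann_integral_imp_has_integral:
  assumes "has_riemann_integral g a b I"
  shows "(g has_integral I) {a..b}"
  unfolding box_real(2)[symmetric] has_integral
proof (intro allI impI)
  fix e :: real
  assume "e > 0"
  from assms[unfolded has_riemann_integral_def, THEN spec, THEN mp, OF this]
  obtain d where d: "d > 0" and D: "\<forall>p.
      p tagged_division_of {a..b} \<and> (\<forall>(x, K)\<in>p. diameter K < d) \<longrightarrow>
      \<bar>(\<Sum>(x, K)\<in>p. measure lborel K * g x) - I\<bar> < e"
    by (elim exE conjE)
  have small: "diameter K < d" if "K \<subseteq> ball x (d / 3)" for x :: real and K
  proof -
    have "diameter K \<le> diameter (ball x (d / 3))"
      using that by (rule diameter_subset) simp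
    also have "\<dots> = 2 * (d / 3)"
      using d by (simp add: diameter_ball)
    also have "\<dots> < d"
      using d by simp
    finally show ?thesis .
  qed
  show "\<exists>\<gamma>. gauge \<gamma> \<and> (\<forall>p. p tagged_division_of cbox a b \<and> \<gamma> fine p \<longrightarrow>
      norm ((\<Sum>(x, K)\<in>p. measure lborel K *\<^sub>R g x) - I) < e)"
  proof (intro exI[of _ "\<lambda>x. ball x (d / 3)"] conjI allI impI)
    show "gauge (\<lambda>x::real. ball x (d / 3))"
      using d by (intro gauge_ball) simp
    fix p assume p: "p tagged_division_of cbox a b \<and> (\<lambda>x. ball x (d / 3)) fine p"
    have "\<forall>(x, K)\<in>p. diameter K < d"
    proof (intro ballI, clarify)
      fix x K assume "(x, K) \<in> p"
      with p have "K \<subseteq> ball x (d / 3)"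
        unfolding fine_def by blast
      then show "diameter K < d"
        by (rule small)
    qed
    with p have "p tagged_division_of {a..b} \<and> (\<forall>(x, K)\<in>p. diameter K < d)"
      unfolding box_real(2) by blast
    from D[THEN spec, THEN mp, OF this]
    show "norm ((\<Sum>(x, K)\<in>p. measure lborel K *\<^sub>R g x) - I) < e"
      unfolding real_norm_def real_scaleR_def .
  qed
qed

lemma riemann_integral_eqI:
  assumes "has_riemann_integral g a b I"
  shows "riemann_integral g a b = I"
  unfolding riemann_integral_def
proof (rule the_equality)
  fix J assume "has_riemann_integral g a b J"
  from this assms show "J = I"
    by (intro has_integral_unique[of g _ "{a..b}"] has_riemann_integral_imp_has_integral)
qed (fact assms)

end

(* In rotated coordinates the pattern at time 2^k is a full square of side 2^k, and for s <= 2^k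
   the pattern at time 2^k + s consists of four corner copies of the pattern at time s around a
   full square of side 2^k - s. Hence num (2^k + s) = 4 num s + (2^k - s)^2, which in the limit says
     F x = F (2 x) / 4                  for x < 1/2,
     F x = F (2 x - 1) + (1 - x)^2      for x >= 1/2.
   An integral I of F must satisfy I = I/8 + I/2 + 1/24, so I = 1/9. Riemann integrability follows by
   squeezing: applying the functional equation to a continuous bound of F, with the jump at 1/2
   smoothed out, gives a better continuous bound, and the integrals of the bounds tend to 1/9. *)

theory Submission
  imports Defs
begin

section \<open>The orbit of the single site seed\<close>

text \<open>Live sites at any time share one parity of \<open>i + j\<close>, so a live center has
  four dead neighbors and dies. Rotation turns opposite neighbors into the diagonals of a 2 x 2
  block and adjacent ones into its sides. The value of \<open>f\<close> for three live neighbors is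
  unknown and must never be evaluated: a block clear of the central square has the four values of a
  block of one copy, so there \<open>f\<close> is only compared with itself. The functional equation
  determines an integral only once it exists, and F is no uniform limit of continuous functions: F
  (1 - 2^-m) tends to 1/3, while F 1 = 1. Enclosing F between continuous functions keeps its Riemann
  sums under control by the mesh alone. Before that, digits given by a description and limits given
  by \<open>lim\<close> must be shown to be the expected objects.\<close>

text \<open>The configuration after \<open>t - 1\<close> steps lives on the sites with \<open>i + j + t - 1\<close> even, and is read
  in the coordinates \<open>p = (i + j + t - 1) / 2\<close>, \<open>q = (i - j + t - 1) / 2\<close>, where the four neighbors
  become a \<open>2 \<times> 2\<close> block. At \<open>t = 0\<close> it is empty, matching \<open>num f 0 = 0\<close>.\<close>

fun rot_state :: "local_rule \<Rightarrow> nat \<Rightarrow> int \<Rightarrow> int \<Rightarrow> bool" where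
  "rot_state f 0 p q = False"
| "rot_state f (Suc 0) p q = (p = 0 \<and> q = 0)"
| "rot_state f (Suc (Suc n)) p q =
     f False (rot_state f (Suc n) p (q - 1)) (rot_state f (Suc n) (p - 1) q)
       (rot_state f (Suc n) (p - 1) (q - 1)) (rot_state f (Suc n) p q)"

lemma rot_state_Suc:
  "t > 0 \<Longrightarrow> rot_state f (Suc t) p q =
     f False (rot_state f t p (q - 1)) (rot_state f t (p - 1) q)
       (rot_state f t (p - 1) (q - 1)) (rot_state f t p q)"
  by (cases t) auto

lemma rule_a_values:
  assumes "rule_a f"
  shows "\<not> f False False False False False" "\<not> f True False False False False"
    "f False True False False False" "f False False True False False"
    "f False False False True False" "f False False False False True"
    "\<not> f False True False True False" "\<not> f False True False False True"
    "\<not> f False False True True False" "\<not> f False False True False True"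
    "f False True True False False" "f False False False True True"
    "f False True True True True"
proof -
  have v: "ones u d l r = 0 \<Longrightarrow> \<not> f False u d l r" "ones u d l r = 0 \<Longrightarrow> \<not> f True u d l r"
    "ones u d l r = 1 \<Longrightarrow> f False u d l r" "ones u d l r = 4 \<Longrightarrow> f False u d l r"
    "ones u d l r = 2 \<Longrightarrow> f False u d l r \<longleftrightarrow> opposite_ones u d l r" for u d l r
    using assms unfolding rule_a_def by metis+
  show "\<not> f False False False False False" "\<not> f True False False False False"
    "f False True False False False" "f False False True False False"
    "f False False False True False" "f False False False False True"
    "\<not> f False True False True False" "\<not> f False True False False True"
    "\<not> f False False True True False" "\<not> f False False True False True"
    "f False True True False False" "f False False False True True"
    "f False True True True True"
    by (simp_all add: v ones_def opposite_ones_def)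
qed

lemma eca_apply:
  "eca f x (i, j) = f (x (i, j)) (x (i, j + 1)) (x (i, j - 1)) (x (i - 1, j)) (x (i + 1, j))"
  by (simp add: eca_def)

text \<open>At a site of the right parity the induction hypothesis makes the center dead and sends
  up, down, left, right to \<open>(p, q - 1)\<close>, \<open>(p - 1, q)\<close>,
  \<open>(p - 1, q - 1)\<close>, \<open>(p, q)\<close>. At the other sites all neighbors are dead,
  and then either state of the center yields 0.\<close>

lemma eca_iterate_rot_state:
  assumes "rule_a f"
  shows "(eca f ^^ n) single_site_seed (i, j) \<longleftrightarrow>
    even (i + j + int n) \<and> rot_state f (Suc n) ((i + j + int n) div 2) ((i - j + int n) div 2)"
proof (induction n arbitrary: i j)
  case 0
  have "(i, j) = (0, 0) \<longleftrightarrow> even (i + j) \<and> (i + j) div 2 = 0 \<and> (i - j) div 2 = 0"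
    unfolding prod.inject by presburger
  then show ?case
    by (simp add: single_site_seed_def)
next
  case (Suc n)
  show ?case
  proof (cases "even (i + j + int (Suc n))")
    case True
    then have e: "odd (i + j + int n)" "even (i + (j + 1) + int n)" "even (i + (j - 1) + int n)"
      "even ((i - 1) + j + int n)" "even ((i + 1) + j + int n)"
      by auto
    have d: "(i + (j + 1) + int n) div 2 = (i + j + int (Suc n)) div 2"
      "(i - (j + 1) + int n) div 2 = (i - j + int (Suc n)) div 2 - 1"
      "(i + (j - 1) + int n) div 2 = (i + j + int (Suc n)) div 2 - 1"
      "(i - (j - 1) + int n) div 2 = (i - j + int (Suc n)) div 2"
      "((i - 1) + j + int n) div 2 = (i + j + int (Suc n)) div 2 - 1"
      "((i - 1) - j + int n) div 2 = (i - j + int (Suc n)) div 2 - 1"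
      "((i + 1) + j + int n) div 2 = (i + j + int (Suc n)) div 2"
      "((i + 1) - j + int n) div 2 = (i - j + int (Suc n)) div 2"
      by presburger+
    have "(eca f ^^ Suc n) single_site_seed (i, j) = eca f ((eca f ^^ n) single_site_seed) (i, j)"
      by simp
    also have "\<dots> = rot_state f (Suc (Suc n)) ((i + j + int (Suc n)) div 2) ((i - j + int (Suc n)) div 2)"
      by (simp only: eca_apply Suc.IH d e rot_state.simps simp_thms)
    finally show ?thesis
      using True by blast
  next
    case False
    then have e: "odd (i + (j + 1) + int n)" "odd (i + (j - 1) + int n)"
      "odd ((i - 1) + j + int n)" "odd ((i + 1) + j + int n)"
      by auto
    have "(eca f ^^ Suc n) single_site_seed (i, j) = eca f ((eca f ^^ n) single_site_seed) (i, j)"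
      by simp
    also have "\<dots> = f ((eca f ^^ n) single_site_seed (i, j)) False False False False"
      using e by (simp only: eca_apply Suc.IH simp_thms)
    also have "\<dots> = False"
      using rule_a_values(1,2)[OF assms] by (cases "(eca f ^^ n) single_site_seed (i, j)") auto
    finally show ?thesis
      using False by blast
  qed
qed

text \<open>The 2 x 2 block of a cell reaches one cell down in each coordinate; outside the square
  of side \<open>t + 1\<close> it misses the square of side \<open>t\<close>.\<close>

lemma rot_state_support:
  assumes "rule_a f" and "rot_state f t p q"
  shows "0 \<le> p \<and> p < int t \<and> 0 \<le> q \<and> q < int t"
  using assms(2)
proof (induction t arbitrary: p q)
  case (Suc t)
  show ?case
  proof (cases "t = 0")
    case False
    show ?thesis
    proof (rule ccontr)
      assume out: "\<not> ?thesis"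
      have "\<not> rot_state f t p (q - 1)" "\<not> rot_state f t (p - 1) q"
        "\<not> rot_state f t (p - 1) (q - 1)" "\<not> rot_state f t p q"
        using Suc.IH out by fastforce+
      with Suc.prems False show False
        by (simp add: rot_state_Suc rule_a_values[OF assms(1)])
    qed
  qed (use Suc.prems in simp)
qed simp

text \<open>The block of a corner meets the previous square only in the corresponding corner, so
  exactly one neighbor is live.\<close>

lemma rot_state_corners:
  assumes "rule_a f" and "t > 0" and "p \<in> {0, int t - 1}" and "q \<in> {0, int t - 1}"
  shows "rot_state f t p q"
  using assms(2-)
proof (induction t arbitrary: p q)
  case (Suc t)
  show ?case
  proof (cases "t = 0")
    case True
    with Suc.prems show ?thesis
      by simp
  next
    case False
    note out = rot_state_support[OF assms(1), of t]
    consider "p = 0" "q = 0" | "p = 0" "q = int t" | "p = int t" "q = 0" | "p = int t" "q = int t"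
      using Suc.prems by auto
    then show ?thesis
    proof cases
      case 1
      have "\<not> rot_state f t p (q - 1)" "\<not> rot_state f t (p - 1) q"
        "\<not> rot_state f t (p - 1) (q - 1)" "rot_state f t p q"
        using out[of p "q - 1"] out[of "p - 1" q] out[of "p - 1" "q - 1"] Suc.IH[of p q] 1 False
        by auto
      with False show ?thesis
        by (simp add: rot_state_Suc rule_a_values[OF assms(1)])
    next
      case 2
      have "rot_state f t p (q - 1)" "\<not> rot_state f t (p - 1) q"
        "\<not> rot_state f t (p - 1) (q - 1)" "\<not> rot_state f t p q"
        using Suc.IH[of p "q - 1"] out[of "p - 1" q] out[of "p - 1" "q - 1"] out[of p q] 2 False
        by auto
      with False show ?thesis
        by (simp add: rot_state_Suc rule_a_values[OF assms(1)])
    next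
      case 3
      have "\<not> rot_state f t p (q - 1)" "rot_state f t (p - 1) q"
        "\<not> rot_state f t (p - 1) (q - 1)" "\<not> rot_state f t p q"
        using out[of p "q - 1"] Suc.IH[of "p - 1" q] out[of "p - 1" "q - 1"] out[of p q] 3 False
        by auto
      with False show ?thesis
        by (simp add: rot_state_Suc rule_a_values[OF assms(1)])
    next
      case 4
      have "\<not> rot_state f t p (q - 1)" "\<not> rot_state f t (p - 1) q"
        "rot_state f t (p - 1) (q - 1)" "\<not> rot_state f t p q"
        using out[of p "q - 1"] out[of "p - 1" q] Suc.IH[of "p - 1" "q - 1"] out[of p q] 4 False
        by auto
      with False show ?thesis
        by (simp add: rot_state_Suc rule_a_values[OF assms(1)])
    qed
  qed
qed simp

text \<open>Coordinate inside a copy, whose offset is 0 or \<open>m\<close>. Unlike reduction mod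
  \<open>m\<close> it does not wrap around: coordinates below 0 or from \<open>2 * m\<close> on stay
  outside the support of a copy.\<close>

definition fold_at :: "int \<Rightarrow> int \<Rightarrow> int" where
  "fold_at m p = (if p < m then p else p - m)"

text \<open>The full square of side \<open>M\<close> leaves, after \<open>s\<close> more steps, a full central square of side \<open>M - s\<close>
  and a copy of the state at time \<open>s\<close> at each corner. The central square meets a copy only
  diagonally, corner to corner, where the value 1 of a single live neighbor is also that of two
  opposite ones; along its sides two adjacent live neighbors give 0.\<close>

lemma rot_state_add:
  assumes f: "rule_a f" and M: "M > 0"
    and full: "\<And>p q. rot_state f M p q \<longleftrightarrow> 0 \<le> p \<and> p < int M \<and> 0 \<le> q \<and> q < int M"
    and "s \<le> M"
  shows "rot_state f (M + s) p q \<longleftrightarrow>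
    (int s \<le> p \<and> p < int M) \<and> (int s \<le> q \<and> q < int M) \<or>
    rot_state f s (fold_at (int M) p) (fold_at (int M) q)"
  using \<open>s \<le> M\<close>
proof (induction s arbitrary: p q)
  case 0
  then show ?case
    by (simp add: full)
next
  case (Suc s)
  then have s: "s < M" by simp
  note vals = rule_a_values[OF f]
  note supp = rot_state_support[OF f]
  let ?r = "fold_at (int M)"
  define c where "c z \<longleftrightarrow> int s \<le> z \<and> z < int M" for z
  define X where "X p q = rot_state f s (?r p) (?r q)" for p q
  have IH: "rot_state f (M + s) p q \<longleftrightarrow> c p \<and> c q \<or> X p q" for p q
    using Suc by (simp add: c_def X_def)
  have step: "rot_state f (M + Suc s) p q =
      f False (c p \<and> c (q - 1) \<or> X p (q - 1)) (c (p - 1) \<and> c q \<or> X (p - 1) q)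
        (c (p - 1) \<and> c (q - 1) \<or> X (p - 1) (q - 1)) (c p \<and> c q \<or> X p q)"
    using M by (simp add: rot_state_Suc IH)
  have out: "\<not> X z w" "\<not> X w z" if "c z" for z w
    using supp[of s "?r z" "?r w"] supp[of s "?r w" "?r z"] that
    by (auto simp: c_def X_def fold_at_def)
  \<comment> \<open>Folding commutes with the step to \<open>p - 1\<close> except at
    \<open>p = M\<close>, where it gives \<open>M - 1\<close> instead of \<open>-1\<close>; both
    miss the support since \<open>s < M\<close>. Hence the copies evolve without seeing one
    another.\<close>
  have shift: "rot_state f s (?r (p - 1)) z = rot_state f s (?r p - 1) z"
    "rot_state f s z (?r (p - 1)) = rot_state f s z (?r p - 1)" for p z
  proof -
    have "?r (p - 1) = ?r p - 1 \<or> ?r (p - 1) \<ge> int s \<and> ?r p - 1 < 0"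
      using s by (auto simp: fold_at_def)
    then show "rot_state f s (?r (p - 1)) z = rot_state f s (?r p - 1) z"
      "rot_state f s z (?r (p - 1)) = rot_state f s z (?r p - 1)"
      using supp[of s "?r (p - 1)" z] supp[of s "?r p - 1" z]
        supp[of s z "?r (p - 1)"] supp[of s z "?r p - 1"] by force+
  qed
  have X_step: "rot_state f (Suc s) (?r p) (?r q) =
      f False (X p (q - 1)) (X (p - 1) q) (X (p - 1) (q - 1)) (X p q)" if "s > 0"
    using that by (simp add: rot_state_Suc X_def shift)
  have X_0: "\<not> X z w" if "s = 0" for z w
    using that by (simp add: X_def)
  have edge: "z = int s \<and> ?r z = int s \<and> ?r (z - 1) = int s - 1" if "c z" "\<not> c (z - 1)" for z
    using that s by (auto simp: c_def fold_at_def)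
  have edge': "z = int M \<and> ?r z = 0 \<and> ?r (z - 1) = int M - 1" if "\<not> c z" "c (z - 1)" for z
    using that s by (auto simp: c_def fold_at_def)
  have bulk: "\<not> rot_state f (Suc s) (?r z) w" "\<not> rot_state f (Suc s) w (?r z)"
    if "c z" "c (z - 1)" for z w
    using supp[of "Suc s" "?r z" w] supp[of "Suc s" w "?r z"] that
    by (auto simp: c_def fold_at_def)
  have goal: "rot_state f (M + Suc s) p q \<longleftrightarrow>
      (c p \<and> c (p - 1)) \<and> (c q \<and> c (q - 1)) \<or> rot_state f (Suc s) (?r p) (?r q)"
  proof -
    \<comment> \<open>The block of \<open>(p, q)\<close> misses the central square, lies in it, or
      straddles a side or a corner of it.\<close>
    consider (none) "\<not> c p \<and> \<not> c (p - 1) \<or> \<not> c q \<and> \<not> c (q - 1)"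
      | (all) "c p" "c (p - 1)" "c q" "c (q - 1)"
      | (side_p) "c p" "c (p - 1)" "c q \<noteq> c (q - 1)"
      | (side_q) "c p \<noteq> c (p - 1)" "c q" "c (q - 1)"
      | (corner) "c p \<noteq> c (p - 1)" "c q \<noteq> c (q - 1)"
      by blast
    then show ?thesis
    proof cases
      case none
      show ?thesis
      \<comment> \<open>The first cell of a copy does not arise by the rule from the empty state at
        time 0, so \<open>s = 0\<close> is separate: the four new cells then have blocks straddling
        a corner, which is excluded here.\<close>
      proof (cases "s = 0")
        case True
        have "\<not> rot_state f (Suc s) (?r p) (?r q)"
          using none True M by (auto simp: c_def fold_at_def split: if_splits)
        with none True show ?thesis
          unfolding step by (auto simp: X_0 vals)
      next
        case False
        then have "rot_state f (Suc s) (?r p) (?r q) =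
            f False (X p (q - 1)) (X (p - 1) q) (X (p - 1) (q - 1)) (X p q)"
          by (simp add: X_step)
        with none show ?thesis
          unfolding step by (elim disjE conjE) simp_all
      qed
    next
      case all
      then show ?thesis
        unfolding step by (simp add: vals)
    next
      case side_p
      then show ?thesis
        unfolding step by (cases "c q") (simp_all add: vals out bulk)
    next
      case side_q
      then show ?thesis
        unfolding step by (cases "c p") (simp_all add: vals out bulk)
    next
      case corner
      have rp: "?r p \<in> {0, int s}" and rq: "?r q \<in> {0, int s}"
        using corner edge edge' by blast+
      then have target: "rot_state f (Suc s) (?r p) (?r q)"
        by (intro rot_state_corners[OF f]) auto
      \<comment> \<open>A cell of the block that is off the central range in both coordinates is a
        corner of a copy, hence live.\<close>
      have val: "X z w" if "z \<in> {p, p - 1}" "\<not> c z" "w \<in> {q, q - 1}" "\<not> c w" "s > 0" for z w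
      proof -
        have "?r z \<in> {0, int s - 1}"
          using that(1,2) corner(1) edge[of p] edge'[of p] by auto
        moreover have "?r w \<in> {0, int s - 1}"
          using that(3,4) corner(2) edge[of q] edge'[of q] by auto
        ultimately show ?thesis
          unfolding X_def using that by (intro rot_state_corners[OF f]) auto
      qed
      have "rot_state f (M + Suc s) p q"
      proof (cases "s = 0")
        case True
        then show ?thesis
          using corner unfolding step
          by (cases "c p"; cases "c q") (simp_all add: X_0 vals)
      next
        case False
        then show ?thesis
          using corner unfolding step
          by (cases "c p"; cases "c q") (simp_all add: val out vals)
      qed
      with target show ?thesis
        by blast
    qed
  qed
  have "c z \<and> c (z - 1) \<longleftrightarrow> int (Suc s) \<le> z \<and> z < int M" for z
    by (auto simp: c_def)
  with goal show ?case
    by simp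
qed

text \<open>At \<open>s = M\<close> in \<open>rot_state_add\<close> the central square has vanished,
  and four full copies tile the square of side \<open>2 * M\<close>.\<close>

lemma rot_state_power2:
  assumes "rule_a f"
  shows "rot_state f (2 ^ k) p q \<longleftrightarrow> 0 \<le> p \<and> p < 2 ^ k \<and> 0 \<le> q \<and> q < 2 ^ k"
proof (induction k arbitrary: p q)
  case 0
  then show ?case
    by auto
next
  case (Suc k)
  have "rot_state f (2 ^ k + 2 ^ k) p q \<longleftrightarrow>
      rot_state f (2 ^ k) (fold_at (2 ^ k) p) (fold_at (2 ^ k) q)"
    using rot_state_add[OF assms, of "2 ^ k" "2 ^ k" p q] Suc by auto
  also have "\<dots> \<longleftrightarrow> 0 \<le> p \<and> p < 2 ^ Suc k \<and> 0 \<le> q \<and> q < 2 ^ Suc k"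
    unfolding Suc by (auto simp: fold_at_def)
  finally have "rot_state f (2 ^ k + 2 ^ k) p q \<longleftrightarrow> 0 \<le> p \<and> p < 2 ^ Suc k \<and> 0 \<le> q \<and> q < 2 ^ Suc k" .
  moreover have "(2 :: nat) ^ Suc k = 2 ^ k + 2 ^ k"
    by simp
  ultimately show ?case
    by metis
qed

section \<open>Counting the live sites\<close>

lemma num_eq_card_rot_state:
  assumes "rule_a f"
  shows "num f t = card {(p, q). rot_state f t p q}"
proof (cases t)
  case 0
  then show ?thesis
    by (simp add: num_def)
next
  case (Suc n)
  let ?y = "(eca f ^^ n) single_site_seed"
  \<comment> \<open>Inverse of the rotated coordinates, with \<open>n = t - 1\<close>; it maps onto
    exactly the sites of the right parity.\<close>
  let ?h = "\<lambda>(p, q). (p + q - int n, p - q)"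
  have "num f t = card {z. ?y z}"
    by (simp add: num_def Suc Sum_any.expand_set)
  also have "{z. ?y z} = ?h ` {(p, q). rot_state f t p q}"
  proof (intro set_eqI iffI)
    fix z assume z: "z \<in> {z. ?y z}"
    obtain i j where ij: "z = (i, j)"
      by (cases z)
    have "rot_state f t ((i + j + int n) div 2) ((i - j + int n) div 2)" "even (i + j + int n)"
      using z by (simp_all add: ij Suc eca_iterate_rot_state[OF assms] del: rot_state.simps)
    moreover from this have "?h ((i + j + int n) div 2, (i - j + int n) div 2) = z"
      unfolding ij prod.case prod.inject by presburger
    ultimately show "z \<in> ?h ` {(p, q). rot_state f t p q}"
      by (metis (mono_tags, lifting) case_prodI image_eqI mem_Collect_eq)
  next
    fix z assume "z \<in> ?h ` {(p, q). rot_state f t p q}"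
    then obtain p q where pq: "rot_state f t p q" and z: "z = (p + q - int n, p - q)"
      by auto
    have e: "p + q - int n + (p - q) + int n = 2 * p" "p + q - int n - (p - q) + int n = 2 * q"
      by simp_all
    show "z \<in> {z. ?y z}"
      unfolding z mem_Collect_eq eca_iterate_rot_state[OF assms] e
      using pq by (simp add: Suc del: rot_state.simps)
  qed
  also have "card \<dots> = card {(p, q). rot_state f t p q}"
    by (intro card_image) (auto simp: inj_on_def)
  finally show ?thesis .
qed

text \<open>The copies are translates of \<open>W\<close> by offsets 0 and \<open>?M\<close> in each
  coordinate. As \<open>W\<close> lies in a square of side \<open>s\<close>, at most
  \<open>?M\<close>, they are disjoint, and all their coordinates are below \<open>s\<close> or at
  least \<open>?M\<close>, off the central range.\<close>

lemma num_power2_add: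
  assumes f: "rule_a f" and s: "s \<le> 2 ^ k"
  shows "num f (2 ^ k + s) = 4 * num f s + (2 ^ k - s) ^ 2"
proof -
  let ?M = "2 ^ k :: int"
  define W where "W = {(p, q). rot_state f s p q}"
  define C where "C = {int s..<?M} \<times> {int s..<?M}"
  define h where "h = (\<lambda>((a, b), (p, q)). (a + p, b + q) :: int \<times> int)"
  define D where "D = ({0, ?M} \<times> {0, ?M}) \<times> W"
  have W: "W \<subseteq> {0..<int s} \<times> {0..<int s}"
    using rot_state_support[OF f] by (auto simp: W_def)
  then have fin: "finite W"
    by (rule finite_subset) simp
  have sM: "int s \<le> ?M"
    using s by (metis of_nat_le_iff of_nat_numeral of_nat_power)
  have W_bound: "0 \<le> p \<and> p < ?M \<and> 0 \<le> q \<and> q < ?M" if "(p, q) \<in> W" for p q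
    using subsetD[OF W that] sM unfolding mem_Times_iff atLeastLessThan_iff fst_conv snd_conv
    by linarith
  have "{(p, q). rot_state f (2 ^ k + s) p q} =
      C \<union> {(p, q). rot_state f s (fold_at ?M p) (fold_at ?M q)}"
    using rot_state_add[OF f, of "2 ^ k" s] s rot_state_power2[OF f, of k]
    by (auto simp: C_def)
  also have "{(p, q). rot_state f s (fold_at ?M p) (fold_at ?M q)} = h ` D"
  proof (intro set_eqI iffI)
    fix z assume z: "z \<in> {(p, q). rot_state f s (fold_at ?M p) (fold_at ?M q)}"
    obtain p q where pq: "z = (p, q)"
      by (cases z)
    have "z = h ((p - fold_at ?M p, q - fold_at ?M q), (fold_at ?M p, fold_at ?M q))"
      by (simp add: h_def pq)
    moreover have "((p - fold_at ?M p, q - fold_at ?M q), (fold_at ?M p, fold_at ?M q)) \<in> D"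
    proof -
      have r: "r - fold_at ?M r \<in> {0, ?M}" for r
        by (simp add: fold_at_def)
      show ?thesis
        unfolding D_def by (intro SigmaI r) (use z in \<open>simp add: W_def pq\<close>)
    qed
    ultimately show "z \<in> h ` D"
      by (rule image_eqI)
  next
    fix z assume "z \<in> h ` D"
    then obtain a b p q where ab: "a \<in> {0, ?M}" "b \<in> {0, ?M}" and pq: "(p, q) \<in> W"
      and z: "z = (a + p, b + q)"
      by (auto simp: h_def D_def)
    have "fold_at ?M (a + p) = p" "fold_at ?M (b + q) = q"
      using ab W_bound[OF pq] by (auto simp: fold_at_def)
    with pq show "z \<in> {(p, q). rot_state f s (fold_at ?M p) (fold_at ?M q)}"
      by (simp add: z W_def)
  qed
  finally have eq: "{(p, q). rot_state f (2 ^ k + s) p q} = C \<union> h ` D" .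
  have "inj_on h D"
  proof (rule inj_onI)
    fix x y assume x: "x \<in> D" and y: "y \<in> D" and xy: "h x = h y"
    obtain a b p q where x': "x = ((a, b), (p, q))"
      by (cases x, cases "fst x", cases "snd x") auto
    obtain a' b' p' q' where y': "y = ((a', b'), (p', q'))"
      by (cases y, cases "fst y", cases "snd y") auto
    have "a \<in> {0, ?M}" "b \<in> {0, ?M}" "a' \<in> {0, ?M}" "b' \<in> {0, ?M}" "(p, q) \<in> W" "(p', q') \<in> W"
      using x y by (auto simp: x' y' D_def)
    moreover have "a + p = a' + p'" "b + q = b' + q'"
      using xy by (auto simp: x' y' h_def)
    ultimately have "a = a'" "b = b'"
      using W_bound[of p q] W_bound[of p' q'] by auto
    then show "x = y"
      using \<open>a + p = a' + p'\<close> \<open>b + q = b' + q'\<close> by (simp add: x' y')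
  qed
  then have "card (h ` D) = 4 * card W"
    by (simp add: card_image D_def card_cartesian_product)
  moreover have "C \<inter> h ` D = {}"
  proof -
    have "(a + p, b + q) \<notin> C" if "a \<in> {0, ?M}" "(p, q) \<in> W" for a b p q
      using that(1) subsetD[OF W that(2)] W_bound[OF that(2)] by (auto simp: C_def)
    then show ?thesis
      by (auto simp: h_def D_def)
  qed
  moreover have "card C = (2 ^ k - s) ^ 2"
  proof -
    have "nat (?M - int s) = 2 ^ k - s"
      by (simp add: nat_diff_distrib' nat_power_eq)
    then show ?thesis
      by (simp add: C_def card_cartesian_product power2_eq_square)
  qed
  moreover have "finite C" "finite (h ` D)"
    using fin by (simp_all add: C_def D_def)
  ultimately show ?thesis
    unfolding num_eq_card_rot_state[OF f] eq W_def[symmetric]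
    by (simp add: card_Un_disjoint)
qed

section \<open>Binary digits\<close>

lemma floor_double_power2:
  fixes x :: real
  shows "\<lfloor>x * 2 ^ Suc k\<rfloor> = 2 * \<lfloor>x * 2 ^ k\<rfloor> + \<lfloor>x * 2 ^ Suc k\<rfloor> mod 2"
proof -
  have "\<lfloor>x * 2 ^ k\<rfloor> = \<lfloor>x * 2 ^ Suc k / real_of_int 2\<rfloor>"
    by simp
  also have "\<dots> = \<lfloor>x * 2 ^ Suc k\<rfloor> div 2"
    by (subst floor_divide_real_eq_div) simp_all
  finally show ?thesis
    by presburger
qed

lemma dyadic_floor_tendsto: "(\<lambda>k. real_of_int \<lfloor>x * 2 ^ k\<rfloor> / 2 ^ k) \<longlonglongrightarrow> x"
proof (rule tendsto_sandwich)
  show "\<forall>\<^sub>F k in sequentially. x - (1 / 2) ^ k \<le> real_of_int \<lfloor>x * 2 ^ k\<rfloor> / 2 ^ k"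
  proof (intro always_eventually allI)
    fix k
    have "x * 2 ^ k - 1 \<le> real_of_int \<lfloor>x * 2 ^ k\<rfloor>"
      by linarith
    then have "(x * 2 ^ k - 1) / 2 ^ k \<le> real_of_int \<lfloor>x * 2 ^ k\<rfloor> / 2 ^ k"
      by (rule divide_right_mono) simp
    then show "x - (1 / 2) ^ k \<le> real_of_int \<lfloor>x * 2 ^ k\<rfloor> / 2 ^ k"
      by (simp add: diff_divide_distrib power_one_over)
  qed
  show "\<forall>\<^sub>F k in sequentially. real_of_int \<lfloor>x * 2 ^ k\<rfloor> / 2 ^ k \<le> x"
    by (intro always_eventually allI) (simp add: field_simps)
  have "(\<lambda>k. x - (1 / 2) ^ k) \<longlonglongrightarrow> x - 0"
    by (intro tendsto_intros LIMSEQ_power_zero) simp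
  then show "(\<lambda>k. x - (1 / 2) ^ k) \<longlonglongrightarrow> x"
    by simp
qed simp

text \<open>Telescoping by \<open>floor_double_power2\<close>; \<open>x < 2\<close> makes the
  integer part a single digit.\<close>

lemma floor_digits_sum:
  fixes x :: real
  assumes "0 \<le> x" "x < 2"
  shows "(\<Sum>i\<le>k. real (nat (\<lfloor>x * 2 ^ i\<rfloor> mod 2)) / 2 ^ i) = real_of_int \<lfloor>x * 2 ^ k\<rfloor> / 2 ^ k"
proof (induction k)
  case 0
  have "\<lfloor>x\<rfloor> = 0 \<or> \<lfloor>x\<rfloor> = 1"
    using assms by linarith
  then show ?case
    by auto
next
  case (Suc k)
  have "real_of_int \<lfloor>x * 2 ^ Suc k\<rfloor> = 2 * real_of_int \<lfloor>x * 2 ^ k\<rfloor> + real_of_int (\<lfloor>x * 2 ^ Suc k\<rfloor> mod 2)"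
    by (subst floor_double_power2) simp
  moreover have "real (nat (\<lfloor>x * 2 ^ Suc k\<rfloor> mod 2)) = real_of_int (\<lfloor>x * 2 ^ Suc k\<rfloor> mod 2)"
    by simp
  ultimately show ?case
    unfolding sum.atMost_Suc Suc by (simp add: add_divide_distrib del: of_nat_nat)
qed

lemma is_binary_expansion_floor_digits:
  fixes x :: real
  assumes "0 \<le> x" "x < 2"
  shows "is_binary_expansion x (\<lambda>i. nat (\<lfloor>x * 2 ^ i\<rfloor> mod 2))"
  unfolding is_binary_expansion_def
proof
  show "\<forall>i. nat (\<lfloor>x * 2 ^ i\<rfloor> mod 2) \<in> {0, 1}"
    by (auto simp: not_mod_2_eq_0_eq_1)
  show "(\<lambda>i. real (nat (\<lfloor>x * 2 ^ i\<rfloor> mod 2)) / 2 ^ i) sums x"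
    unfolding sums_def_le floor_digits_sum[OF assms] by (rule dyadic_floor_tendsto)
qed

lemma finite_floor_digits:
  fixes x :: real
  assumes "x * 2 ^ K = real_of_int m"
  shows "finite {i. nat (\<lfloor>x * 2 ^ i\<rfloor> mod 2) \<noteq> 0}"
proof (rule finite_subset)
  show "{i. nat (\<lfloor>x * 2 ^ i\<rfloor> mod 2) \<noteq> 0} \<subseteq> {..K}"
  proof (rule subsetI, rule ccontr)
    fix i assume i: "i \<in> {i. nat (\<lfloor>x * 2 ^ i\<rfloor> mod 2) \<noteq> 0}" "i \<notin> {..K}"
    then obtain d where d: "i = K + Suc d"
      by (metis atMost_iff less_imp_Suc_add not_le add_Suc_right)
    have "x * 2 ^ i = (x * 2 ^ K) * 2 ^ Suc d"
      by (simp add: d power_add)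
    also have "\<dots> = real_of_int (m * 2 ^ Suc d)"
      by (simp add: assms)
    finally have "\<lfloor>x * 2 ^ i\<rfloor> = m * 2 ^ Suc d"
      by (metis floor_of_int)
    with i(1) show False
      by simp
  qed
qed simp

lemma partial_expansion_integer:
  fixes b :: "nat \<Rightarrow> nat"
  shows "(\<Sum>i\<le>k. real (b i) / 2 ^ i) * 2 ^ k = real (\<Sum>i\<le>k. b i * 2 ^ (k - i))"
proof -
  have "real (b i) / 2 ^ i * 2 ^ k = real (b i * 2 ^ (k - i))" if "i \<le> k" for i
  proof -
    have "(2 :: real) ^ k = 2 ^ (k - i) * 2 ^ i"
      using that by (simp flip: power_add)
    then show ?thesis
      by simp
  qed
  then show ?thesis
    by (simp add: sum_distrib_right)
qed

text \<open>For the partial sums \<open>?P k\<close> of an admissible expansion,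
  \<open>?P k <= x < ?P k + (1 / 2) ^ k\<close> gives the floor of \<open>x * 2 ^ k\<close>, whose
  parity is digit \<open>k\<close>. The strict bound is the point: equality at one \<open>k\<close>
  would persist and force all later digits to be 1, while \<open>x\<close> would be dyadic with
  finitely many floor digits, so the preference for finite expansions would exclude
  \<open>b\<close>.\<close>

lemma binary_digits_eq:
  assumes x: "0 \<le> x" "x < 2"
  shows "binary_digits x = (\<lambda>i. nat (\<lfloor>x * 2 ^ i\<rfloor> mod 2))"
  unfolding binary_digits_def
proof (rule the_equality)
  let ?c = "\<lambda>i. nat (\<lfloor>x * 2 ^ i\<rfloor> mod 2)"
  have c: "is_binary_expansion x ?c"
    by (rule is_binary_expansion_floor_digits[OF x])
  moreover have "finite {i. ?c i \<noteq> 0}"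
    if b: "is_binary_expansion x b" and fin: "finite {i. b i \<noteq> 0}" for b
  proof -
    obtain K where K: "\<And>i. b i \<noteq> 0 \<Longrightarrow> i \<le> K"
      using fin unfolding finite_nat_set_iff_bounded_le by blast
    have "(\<lambda>i. real (b i) / 2 ^ i) sums (\<Sum>i\<le>K. real (b i) / 2 ^ i)"
      using K by (intro sums_finite) auto
    with b have "x = (\<Sum>i\<le>K. real (b i) / 2 ^ i)"
      by (auto simp: is_binary_expansion_def dest: sums_unique2)
    then have "x * 2 ^ K = real_of_int (int (\<Sum>i\<le>K. b i * 2 ^ (K - i)))"
      by (simp add: partial_expansion_integer del: of_nat_sum)
    then show ?thesis
      by (rule finite_floor_digits)
  qed
  ultimately show "is_binary_expansion x ?c \<and>
      ((\<exists>b'. is_binary_expansion x b' \<and> finite {i. b' i \<noteq> 0}) \<longrightarrow> finite {i. ?c i \<noteq> 0})"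
    by blast
  fix b assume "is_binary_expansion x b \<and>
      ((\<exists>b'. is_binary_expansion x b' \<and> finite {i. b' i \<noteq> 0}) \<longrightarrow> finite {i. b i \<noteq> 0})"
  then have b: "is_binary_expansion x b"
    and fin: "finite {i. ?c i \<noteq> 0} \<Longrightarrow> finite {i. b i \<noteq> 0}"
    using c by blast+
  have b01: "b i = 0 \<or> b i = 1" for i
    using b by (auto simp: is_binary_expansion_def)
  let ?P = "\<lambda>k. (\<Sum>i\<le>k. real (b i) / 2 ^ i)"
  have sums: "(\<lambda>i. real (b i) / 2 ^ i) sums x"
    using b by (simp add: is_binary_expansion_def)
  have lower: "?P k \<le> x" for k
    using sum_le_suminf[OF sums_summable[OF sums], of "{..k}"] sums_unique[OF sums] by simp
  have upper: "x < ?P k + (1 / 2) ^ k" for k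
  proof (rule ccontr)
    assume not_less: "\<not> x < ?P k + (1 / 2) ^ k"
    have mono: "?P j + (1 / 2) ^ j \<le> ?P i + (1 / 2) ^ i" if "i \<le> j" for i j
      using that
    proof (induction j rule: dec_induct)
      case (step j)
      have "real (b (Suc j)) / 2 ^ Suc j \<le> (1 / 2) ^ Suc j"
        using b01[of "Suc j"] by (auto simp: power_one_over)
      then have "?P (Suc j) + (1 / 2) ^ Suc j \<le> ?P j + (1 / 2) ^ j"
        by simp
      with step.IH show ?case
        by linarith
    qed simp
    have gap: "x \<le> ?P j + (1 / 2) ^ j" for j
    proof (rule LIMSEQ_le_const2)
      show "?P \<longlonglongrightarrow> x"
        using sums by (simp add: sums_def_le)
      have "?P i \<le> ?P j + (1 / 2) ^ j" if "j \<le> i" for i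
        using mono[OF that] zero_le_power[of "1 / 2 :: real" i] by linarith
      then show "\<exists>N. \<forall>n\<ge>N. ?P n \<le> ?P j + (1 / 2) ^ j"
        by blast
    qed
    have eq: "x = ?P j + (1 / 2) ^ j" if "k \<le> j" for j
      using mono[OF that] gap[of j] not_less by linarith
    have "b (Suc j) = 1" if "k \<le> j" for j
      using eq[OF that] eq[of "Suc j"] that b01[of "Suc j"] by (auto simp: power_one_over field_simps)
    then have "Suc ` {k..} \<subseteq> {i. b i \<noteq> 0}"
      by auto
    moreover have "infinite (Suc ` {k..})"
      by (simp add: finite_image_iff infinite_Ici)
    ultimately have inf: "infinite {i. b i \<noteq> 0}"
      by (rule infinite_super)
    have "x * 2 ^ k = ?P k * 2 ^ k + 1"
      by (subst eq[of k]) (simp_all add: power_one_over distrib_right)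
    also have "\<dots> = real_of_int (int (\<Sum>i\<le>k. b i * 2 ^ (k - i)) + 1)"
      by (simp add: partial_expansion_integer del: of_nat_sum)
    finally have "finite {i. ?c i \<noteq> 0}"
      by (rule finite_floor_digits)
    with fin inf show False
      by blast
  qed
  have floor_eq: "\<lfloor>x * 2 ^ k\<rfloor> = int (\<Sum>i\<le>k. b i * 2 ^ (k - i))" for k
  proof (rule floor_unique)
    have e: "real_of_int (int (\<Sum>i\<le>k. b i * 2 ^ (k - i))) = ?P k * 2 ^ k"
      by (simp add: partial_expansion_integer del: of_nat_sum)
    show "real_of_int (int (\<Sum>i\<le>k. b i * 2 ^ (k - i))) \<le> x * 2 ^ k"
      unfolding e using lower by (intro mult_right_mono) auto
    have "x * 2 ^ k < (?P k + (1 / 2) ^ k) * 2 ^ k"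
      using upper by (intro mult_strict_right_mono) auto
    then show "x * 2 ^ k < real_of_int (int (\<Sum>i\<le>k. b i * 2 ^ (k - i))) + 1"
      unfolding e by (simp add: power_one_over distrib_right)
  qed
  show "b = ?c"
  proof
    fix k
    have "(\<Sum>i\<le>k. b i * 2 ^ (k - i)) mod 2 = b k"
    proof -
      have "(\<Sum>i\<le>k. b i * 2 ^ (k - i)) = (\<Sum>i<k. b i * 2 ^ (k - i)) + b k"
        by (simp add: lessThan_Suc_atMost[symmetric])
      moreover have "even (\<Sum>i<k. b i * 2 ^ (k - i))"
        by (intro dvd_sum) auto
      ultimately show ?thesis
        using b01[of k] by presburger
    qed
    then show "b k = ?c k"
      unfolding floor_eq by (simp add: nat_mod_distrib del: of_nat_sum)
  qed
qed

lemma binary_truncation_eq: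
  assumes "0 \<le> x" "x < 2"
  shows "binary_truncation x k = real_of_int \<lfloor>x * 2 ^ k\<rfloor> / 2 ^ k"
  unfolding binary_truncation_def binary_digits_eq[OF assms] by (rule floor_digits_sum[OF assms])

section \<open>The limit function\<close>

text \<open>All that the analysis needs of the automaton. The case \<open>s = 2 ^ k\<close> serves
  the point \<open>x = 1\<close>.\<close>

locale doubling_count =
  fixes N :: "nat \<Rightarrow> nat"
  assumes N_0: "N 0 = 0"
    and N_add: "s \<le> 2 ^ k \<Longrightarrow> N (2 ^ k + s) = 4 * N s + (2 ^ k - s) ^ 2"
begin

lemma N_power2: "N (2 ^ k) = 4 ^ k"
  using N_add[of 0 k] by (simp add: N_0 power2_eq_square flip: power_mult_distrib)

text \<open>With \<open>2 ^ k = s + d\<close> the recursion gives at most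
  \<open>4 * s ^ 2 + d ^ 2\<close>, and \<open>t = 2 * s + d\<close>. This keeps the normalized
  counts below 1.\<close>

lemma N_le_square: "N t \<le> t ^ 2"
proof (induction t rule: less_induct)
  case (less t)
  show ?case
  proof (cases "t = 0")
    case True
    then show ?thesis
      by (simp add: N_0)
  next
    case False
    then obtain k where k: "2 ^ k \<le> t" "t < 2 ^ (k + 1)"
      using ex_power_ivl1[of 2 t] by auto
    define s where "s = t - 2 ^ k"
    have s: "t = 2 ^ k + s" "s \<le> 2 ^ k"
      using k by (simp_all add: s_def)
    have "N s \<le> s ^ 2"
      using s by (intro less.IH) simp
    moreover obtain d where d: "2 ^ k = s + d"
      using s(2) le_Suc_ex by blast
    moreover have "N t = 4 * N s + (2 ^ k - s) ^ 2"
      unfolding s(1) by (rule N_add[OF s(2)])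
    ultimately have "N t \<le> 4 * s ^ 2 + d ^ 2"
      by simp
    also have "\<dots> \<le> t ^ 2"
      unfolding s(1) d by (simp add: power2_eq_square algebra_simps)
    finally show ?thesis .
  qed
qed

text \<open>The normalized count at the truncated argument, by \<open>N (2 ^ k) = 4 ^ k\<close>; in
  this form, dropping a leading digit of \<open>x\<close> is a shift of \<open>k\<close>.\<close>

definition scaled :: "nat \<Rightarrow> real \<Rightarrow> real" where
  "scaled k x = real (N (nat \<lfloor>x * 2 ^ k\<rfloor>)) / 4 ^ k"

lemma scaled_bounds:
  assumes "x \<in> {0..1}"
  shows "0 \<le> scaled k x" "scaled k x \<le> 1"
proof -
  have "x * 2 ^ k \<le> 2 ^ k"
    using assms by (simp add: mult_left_le_one_le)
  then have "\<lfloor>x * 2 ^ k\<rfloor> \<le> 2 ^ k"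
    using floor_mono[of "x * 2 ^ k" "2 ^ k"] by simp
  then have "nat \<lfloor>x * 2 ^ k\<rfloor> \<le> 2 ^ k"
    by (simp add: nat_le_iff)
  then have "N (nat \<lfloor>x * 2 ^ k\<rfloor>) \<le> (2 ^ k) ^ 2"
    using N_le_square power_mono order_trans by blast
  also have "\<dots> = 4 ^ k"
    by (simp add: power2_eq_square flip: power_mult_distrib)
  finally have "real (N (nat \<lfloor>x * 2 ^ k\<rfloor>)) \<le> real (4 ^ k)"
    by (rule of_nat_mono)
  then show "scaled k x \<le> 1"
    by (simp add: scaled_def)
qed (simp add: scaled_def)

lemma scaled_one: "scaled k 1 = 1"
  by (simp add: scaled_def nat_power_eq N_power2)

lemma scaled_Suc: "scaled (Suc k) x = scaled k (2 * x) / 4"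
  by (simp add: scaled_def mult_ac)

lemma scaled_Suc_right:
  assumes x: "1 / 2 \<le> x" "x \<le> 1"
  shows "scaled (Suc k) x =
    scaled k (2 * x - 1) + (1 - real_of_int \<lfloor>(2 * x - 1) * 2 ^ k\<rfloor> / 2 ^ k) ^ 2 / 4"
proof -
  define m where "m = \<lfloor>(2 * x - 1) * 2 ^ k\<rfloor>"
  have "0 \<le> (2 * x - 1) * 2 ^ k"
    using x by simp
  moreover have "(2 * x - 1) * 2 ^ k \<le> 2 ^ k"
    using x by (simp add: mult_left_le_one_le)
  ultimately have m: "0 \<le> m" "m \<le> 2 ^ k"
    unfolding m_def using floor_mono[of "(2 * x - 1) * 2 ^ k" "2 ^ k"] by simp_all
  then obtain s where s: "m = int s"
    using nonneg_int_cases by blast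
  have sk: "s \<le> 2 ^ k"
    using m s by (metis of_nat_le_iff of_nat_numeral of_nat_power)
  have "x * 2 ^ Suc k = (2 * x - 1) * 2 ^ k + real_of_int (2 ^ k)"
    by (simp add: algebra_simps)
  then have "\<lfloor>x * 2 ^ Suc k\<rfloor> = m + 2 ^ k"
    unfolding m_def by (metis floor_add_int)
  then have "nat \<lfloor>x * 2 ^ Suc k\<rfloor> = 2 ^ k + s"
    by (simp add: s nat_add_distrib nat_power_eq)
  then have "scaled (Suc k) x = real (4 * N s + (2 ^ k - s) ^ 2) / 4 ^ Suc k"
    by (simp add: scaled_def N_add[OF sk])
  also have "\<dots> = real (N s) / 4 ^ k + (2 ^ k - real s) ^ 2 / 4 ^ k / 4"
    using sk by (simp add: of_nat_diff add_divide_distrib)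
  also have "(2 ^ k - real s) ^ 2 / 4 ^ k = ((2 ^ k - real s) / 2 ^ k) ^ 2"
    by (simp add: power_divide power2_eq_square flip: power_mult_distrib)
  also have "(2 ^ k - real s) / 2 ^ k = 1 - real s / 2 ^ k"
    by (simp add: field_simps)
  finally show ?thesis
    by (simp add: scaled_def s flip: m_def)
qed

lemma correction_tendsto:
  "(\<lambda>k. (1 - real_of_int \<lfloor>(2 * x - 1) * 2 ^ k\<rfloor> / 2 ^ k) ^ 2 / 4) \<longlonglongrightarrow> (1 - x) ^ 2"
proof -
  have "(\<lambda>k. (1 - real_of_int \<lfloor>(2 * x - 1) * 2 ^ k\<rfloor> / 2 ^ k) ^ 2 / 4)
      \<longlonglongrightarrow> (1 - (2 * x - 1)) ^ 2 / 4"
    by (intro tendsto_intros dyadic_floor_tendsto) simp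
  moreover have "(1 - (2 * x - 1)) ^ 2 / 4 = (1 - x) ^ 2"
    by (simp add: power2_eq_square field_simps)
  ultimately show ?thesis
    by simp
qed

text \<open>The sequence does not converge uniformly in \<open>x\<close>, since the digit 1 preserves oscillations. But
  the digit 0 divides them by 4, and for \<open>x < 1\<close> there is always another digit 0.\<close>

definition osc_le :: "real \<Rightarrow> real \<Rightarrow> bool" where
  "osc_le c x \<longleftrightarrow> (\<forall>e>0. \<exists>K. \<forall>j\<ge>K. \<forall>k\<ge>K. \<bar>scaled j x - scaled k x\<bar> < c + e)"

lemma osc_le_left:
  assumes "osc_le c (2 * x)"
  shows "osc_le (c / 4) x"
  unfolding osc_le_def
proof (intro allI impI)
  fix e :: real
  assume "e > 0"
  then have "4 * e > 0" by simp
  with assms obtain K where K: "\<And>j k. j \<ge> K \<Longrightarrow> k \<ge> K \<Longrightarrow>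
      \<bar>scaled j (2 * x) - scaled k (2 * x)\<bar> < c + 4 * e"
    unfolding osc_le_def by blast
  show "\<exists>K. \<forall>j\<ge>K. \<forall>k\<ge>K. \<bar>scaled j x - scaled k x\<bar> < c / 4 + e"
  proof (intro exI[of _ "Suc K"] allI impI)
    fix j k assume "Suc K \<le> j" "Suc K \<le> k"
    then obtain j' k' where "j = Suc j'" "k = Suc k'" "K \<le> j'" "K \<le> k'"
      by (metis Suc_le_D Suc_le_mono)
    then show "\<bar>scaled j x - scaled k x\<bar> < c / 4 + e"
      using K[of j' k'] by (simp add: scaled_Suc flip: diff_divide_distrib)
  qed
qed

lemma osc_le_right:
  assumes x: "1 / 2 \<le> x" "x \<le> 1" and osc: "osc_le c (2 * x - 1)"
  shows "osc_le c x"
  unfolding osc_le_def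
proof (intro allI impI)
  fix e :: real
  assume "e > 0"
  then have e: "e / 2 > 0" by simp
  let ?v = "\<lambda>k. (1 - real_of_int \<lfloor>(2 * x - 1) * 2 ^ k\<rfloor> / 2 ^ k) ^ 2 / 4"
  obtain K where K: "\<And>j k. j \<ge> K \<Longrightarrow> k \<ge> K \<Longrightarrow>
      \<bar>scaled j (2 * x - 1) - scaled k (2 * x - 1)\<bar> < c + e / 2"
    using osc e unfolding osc_le_def by blast
  have "Cauchy ?v"
    using correction_tendsto by (rule LIMSEQ_imp_Cauchy)
  then obtain L where L: "\<And>j k. j \<ge> L \<Longrightarrow> k \<ge> L \<Longrightarrow> \<bar>?v j - ?v k\<bar> < e / 2"
    using e unfolding Cauchy_def dist_real_def by blast
  show "\<exists>K. \<forall>j\<ge>K. \<forall>k\<ge>K. \<bar>scaled j x - scaled k x\<bar> < c + e"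
  proof (intro exI[of _ "Suc (max K L)"] allI impI)
    fix j k assume "Suc (max K L) \<le> j" "Suc (max K L) \<le> k"
    then obtain j' k' where jk: "j = Suc j'" "k = Suc k'" "max K L \<le> j'" "max K L \<le> k'"
      by (metis Suc_le_D Suc_le_mono)
    show "\<bar>scaled j x - scaled k x\<bar> < c + e"
      unfolding jk(1,2) scaled_Suc_right[OF x]
      using K[of j' k'] L[of j' k'] jk(3,4) by linarith
  qed
qed

text \<open>The map \<open>2 * x - 1\<close> doubles the distance from 1, so from
  \<open>y <= 1 - (1 / 2) ^ m\<close> at most \<open>m\<close> steps lead below 1/2, where the digit
  0 gains the factor 1/4. The bound \<open>c\<close> is assumed on the whole interval because the
  point then reached is arbitrary. At 1 the sequence is constant.\<close>

lemma osc_le_quarter: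
  assumes c: "0 \<le> c" and all: "\<And>x. x \<in> {0..1} \<Longrightarrow> osc_le c x" and x: "x \<in> {0..1}"
  shows "osc_le (c / 4) x"
proof (cases "x = 1")
  case True
  then show ?thesis
    using c by (auto simp: osc_le_def scaled_one)
next
  case False
  have "osc_le (c / 4) y" if "0 \<le> y" "y \<le> 1 - (1 / 2) ^ m" for y m
    using that
  proof (induction m arbitrary: y)
    case 0
    then show ?case
      using all[of "2 * y"] by (simp add: osc_le_left)
  next
    case (Suc m)
    show ?case
    proof (cases "y < 1 / 2")
      case True
      then show ?thesis
        using Suc.prems all[of "2 * y"] by (simp add: osc_le_left)
    next
      case False
      have "y \<le> 1"
        using Suc.prems(2) zero_le_power[of "1 / 2 :: real" "Suc m"] by linarith
      moreover have "osc_le (c / 4) (2 * y - 1)"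
        using Suc.prems False by (intro Suc.IH) auto
      ultimately show ?thesis
        using False by (simp add: osc_le_right)
    qed
  qed
  moreover obtain m where "(1 / 2) ^ m < 1 - x"
    using real_arch_pow_inv[of "1 - x" "1 / 2"] x False by auto
  ultimately show ?thesis
    using x by (smt (verit) atLeastAtMost_iff)
qed

lemma convergent_scaled:
  assumes x: "x \<in> {0..1}"
  shows "convergent (\<lambda>k. scaled k x)"
proof -
  have osc: "osc_le ((1 / 4) ^ n) y" if "y \<in> {0..1}" for n y
    using that
  proof (induction n arbitrary: y)
    case 0
    have "\<bar>scaled j y - scaled k y\<bar> \<le> 1" for j k
      using scaled_bounds[OF 0, of j] scaled_bounds[OF 0, of k] by linarith
    then have "\<bar>scaled j y - scaled k y\<bar> < 1 + e" if "e > 0" for j k and e :: real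
      using that by (rule_tac le_less_trans[of _ 1]) auto
    then show ?case
      by (simp add: osc_le_def)
  next
    case (Suc n)
    then show ?case
      using osc_le_quarter[of "(1 / 4) ^ n" y] by simp
  qed
  have "Cauchy (\<lambda>k. scaled k x)"
    unfolding Cauchy_def dist_real_def
  proof (intro allI impI)
    fix e :: real
    assume e: "e > 0"
    then obtain n where n: "(1 / 4) ^ n < e"
      using real_arch_pow_inv[of e "1 / 4"] by auto
    then have "e - (1 / 4) ^ n > 0" by simp
    from osc[OF x, of n, unfolded osc_le_def, rule_format, OF this]
    show "\<exists>M. \<forall>m\<ge>M. \<forall>n\<ge>M. \<bar>scaled m x - scaled n x\<bar> < e"
      by simp
  qed
  then show ?thesis
    by (rule Cauchy_convergent)
qed

lemma scaled_tendsto_lim: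
  "x \<in> {0..1} \<Longrightarrow> (\<lambda>k. scaled k x) \<longlonglongrightarrow> lim (\<lambda>k. scaled k x)"
  using convergent_scaled by (simp add: convergent_LIMSEQ_iff)

lemma lim_scaled_bounds:
  assumes "x \<in> {0..1}"
  shows "0 \<le> lim (\<lambda>k. scaled k x)" "lim (\<lambda>k. scaled k x) \<le> 1"
  using scaled_tendsto_lim[OF assms] scaled_bounds[OF assms]
  by (blast intro: LIMSEQ_le_const LIMSEQ_le_const2)+

section \<open>Functional equation of the limit\<close>

lemma lim_scaled_left:
  assumes "0 \<le> x" "x < 1 / 2"
  shows "lim (\<lambda>k. scaled k x) = lim (\<lambda>k. scaled k (2 * x)) / 4"
proof -
  have "(\<lambda>k. scaled (Suc k) x) \<longlonglongrightarrow> lim (\<lambda>k. scaled k (2 * x)) / 4"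
    unfolding scaled_Suc using assms by (intro tendsto_intros scaled_tendsto_lim) auto
  then show ?thesis
    by (intro limI) (rule LIMSEQ_imp_Suc)
qed

lemma lim_scaled_right:
  assumes x: "1 / 2 \<le> x" "x \<le> 1"
  shows "lim (\<lambda>k. scaled k x) = lim (\<lambda>k. scaled k (2 * x - 1)) + (1 - x) ^ 2"
proof -
  have "(\<lambda>k. scaled (Suc k) x) \<longlonglongrightarrow> lim (\<lambda>k. scaled k (2 * x - 1)) + (1 - x) ^ 2"
    unfolding scaled_Suc_right[OF x] using x
    by (intro tendsto_add scaled_tendsto_lim correction_tendsto) auto
  then show ?thesis
    by (intro limI) (rule LIMSEQ_imp_Suc)
qed

end

lemma limit_function_eq:
  assumes "doubling_count (num f)" and x: "x \<in> {0..1}"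
  shows "limit_function f x = lim (\<lambda>k. doubling_count.scaled (num f) k x)"
proof -
  interpret doubling_count "num f" by fact
  have "normalized_num f k (binary_truncation x k) = scaled k x" for k
    using x by (simp add: normalized_num_def binary_truncation_eq scaled_def N_power2)
  then show ?thesis
    by (simp add: limit_function_def)
qed

section \<open>Riemann integrals of self-similar functions\<close>

text \<open>Uniform continuity supplies one mesh bound for all tags, where a gauge could vary with
  the tag.\<close>

lemma has_riemann_integral_continuous:
  fixes h :: "real \<Rightarrow> real"
  assumes h: "continuous_on {a..b} h"
  shows "has_riemann_integral h a b (integral {a..b} h)"
  unfolding has_riemann_integral_def
proof (intro allI impI)
  fix e :: real
  assume e: "e > 0"
  \<comment> \<open>The summand 1 avoids division by zero when the interval has measure 0.\<close>
  define e' where "e' = e / (measure lborel {a..b} + 1)"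
  have e': "e' > 0" "e' * measure lborel {a..b} < e"
    using e by (simp_all add: e'_def add_nonneg_pos field_simps)
  have "uniformly_continuous_on {a..b} h"
    using h by (intro compact_uniformly_continuous) auto
  then obtain d where d: "d > 0"
    and D: "\<And>x y. x \<in> {a..b} \<Longrightarrow> y \<in> {a..b} \<Longrightarrow> dist y x < d \<Longrightarrow> dist (h y) (h x) < e'"
    using e'(1) unfolding uniformly_continuous_on_def by metis
  show "\<exists>d>0. \<forall>p. p tagged_division_of {a..b} \<and> (\<forall>(x, K)\<in>p. diameter K < d) \<longrightarrow>
      \<bar>(\<Sum>(x, K)\<in>p. measure lborel K * h x) - integral {a..b} h\<bar> < e"
  proof (intro exI[of _ d] conjI allI impI d)
    fix p assume "p tagged_division_of {a..b} \<and> (\<forall>(x, K)\<in>p. diameter K < d)"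
    then have p: "p tagged_division_of {a..b}" and mesh: "\<And>x K. (x, K) \<in> p \<Longrightarrow> diameter K < d"
      by auto
    have piece: "\<bar>measure lborel K * h x - integral K h\<bar> \<le> e' * measure lborel K"
      if xK: "(x, K) \<in> p" for x K
    proof -
      obtain u v where uv: "K = {u..v}"
        using tagged_division_ofD(4)[OF p xK] by auto
      have sub: "K \<subseteq> {a..b}" and x: "x \<in> K"
        using tagged_division_ofD(2,3)[OF p xK] by auto
      have int: "h integrable_on K"
        unfolding uv using sub uv h by (intro integrable_continuous_real) (auto intro: continuous_on_subset)
      have bound: "\<bar>h x - h y\<bar> \<le> e'" if y: "y \<in> K" for y
      proof -
        have "dist x y \<le> diameter K"
          using x y by (intro diameter_bounded_bound) (auto simp: uv)
        then have "dist x y < d"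
          using mesh[OF xK] by simp
        moreover have "x \<in> {a..b}" "y \<in> {a..b}"
          using sub x y by blast+
        ultimately show ?thesis
          using D[of y x] by (simp add: dist_real_def)
      qed
      have "measure lborel K * h x - integral K h = integral K (\<lambda>y. h x - h y)"
        unfolding uv using int[unfolded uv] x[unfolded uv]
        by (subst integral_diff) (simp_all add: integrable_const_ivl)
      also have "\<bar>\<dots>\<bar> \<le> e' * measure lborel (cbox u v)"
        unfolding real_norm_def[symmetric] uv box_real(2)[symmetric]
        using e'(1) bound int
        by (intro integrable_bound integrable_diff) (auto simp: uv)
      finally show ?thesis
        by (simp add: uv)
    qed
    have "integral {a..b} h = (\<Sum>(x, K)\<in>p. integral K h)"
      using integral_combine_tagged_division_topdown[of h a b p] p h
      by (simp add: integrable_continuous_real)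
    then have "\<bar>(\<Sum>(x, K)\<in>p. measure lborel K * h x) - integral {a..b} h\<bar>
        = \<bar>\<Sum>(x, K)\<in>p. measure lborel K * h x - integral K h\<bar>"
      by (simp add: sum_subtractf case_prod_beta)
    also have "\<dots> \<le> (\<Sum>(x, K)\<in>p. e' * measure lborel K)"
      by (rule order_trans[OF sum_abs sum_mono]) (auto simp: piece)
    also have "\<dots> = e' * measure lborel {a..b}"
      using additive_content_tagged_division[of p a b] p
      by (simp add: sum_distrib_left[symmetric] case_prod_beta)
    also have "\<dots> < e"
      by (fact e'(2))
    finally show "\<bar>(\<Sum>(x, K)\<in>p. measure lborel K * h x) - integral {a..b} h\<bar> < e" .
  qed
qed

text \<open>Riemann sums are monotone in the integrand, the weights being nonnegative; on a fine
  partition the sum of \<open>F\<close> lies between sums within \<open>e / 2\<close> of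
  \<open>Ig\<close> and \<open>Ih\<close>.\<close>

lemma has_riemann_integral_squeeze:
  assumes "\<And>e. e > 0 \<Longrightarrow> \<exists>g h Ig Ih. has_riemann_integral g a b Ig \<and> has_riemann_integral h a b Ih \<and>
    (\<forall>x\<in>{a..b}. g x \<le> F x \<and> F x \<le> h x) \<and> I - e < Ig \<and> Ih < I + e"
  shows "has_riemann_integral F a b I"
  unfolding has_riemann_integral_def
proof (intro allI impI)
  fix e :: real
  assume "e > 0"
  then have e: "e / 2 > 0" by simp
  obtain g h Ig Ih where g: "has_riemann_integral g a b Ig" and h: "has_riemann_integral h a b Ih"
    and le: "\<And>x. x \<in> {a..b} \<Longrightarrow> g x \<le> F x \<and> F x \<le> h x" and I: "I - e / 2 < Ig" "Ih < I + e / 2"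
    using assms[OF e] by blast
  from g[unfolded has_riemann_integral_def, THEN spec, THEN mp, OF e]
  obtain d1 where d1: "d1 > 0" and D1: "\<forall>p. p tagged_division_of {a..b} \<and>
      (\<forall>(x, K)\<in>p. diameter K < d1) \<longrightarrow> \<bar>(\<Sum>(x, K)\<in>p. measure lborel K * g x) - Ig\<bar> < e / 2"
    by (elim exE conjE)
  from h[unfolded has_riemann_integral_def, THEN spec, THEN mp, OF e]
  obtain d2 where d2: "d2 > 0" and D2: "\<forall>p. p tagged_division_of {a..b} \<and>
      (\<forall>(x, K)\<in>p. diameter K < d2) \<longrightarrow> \<bar>(\<Sum>(x, K)\<in>p. measure lborel K * h x) - Ih\<bar> < e / 2"
    by (elim exE conjE)
  show "\<exists>d>0. \<forall>p. p tagged_division_of {a..b} \<and> (\<forall>(x, K)\<in>p. diameter K < d) \<longrightarrow>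
      \<bar>(\<Sum>(x, K)\<in>p. measure lborel K * F x) - I\<bar> < e"
  proof (intro exI[of _ "min d1 d2"] conjI allI impI)
    fix p assume p': "p tagged_division_of {a..b} \<and> (\<forall>(x, K)\<in>p. diameter K < min d1 d2)"
    then have p: "p tagged_division_of {a..b}" and mesh: "\<forall>(x, K)\<in>p. diameter K < d1"
      "\<forall>(x, K)\<in>p. diameter K < d2"
      by auto
    have mem: "x \<in> {a..b}" if "(x, K) \<in> p" for x K
      using tagged_division_ofD(2,3)[OF p that] by auto
    have "(\<Sum>(x, K)\<in>p. measure lborel K * g x) \<le> (\<Sum>(x, K)\<in>p. measure lborel K * F x)"
      "(\<Sum>(x, K)\<in>p. measure lborel K * F x) \<le> (\<Sum>(x, K)\<in>p. measure lborel K * h x)"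
      using le mem by (auto intro!: sum_mono mult_left_mono)
    with D1[THEN spec, THEN mp, OF conjI[OF p mesh(1)]] D2[THEN spec, THEN mp, OF conjI[OF p mesh(2)]] I
    show "\<bar>(\<Sum>(x, K)\<in>p. measure lborel K * F x) - I\<bar> < e"
      by linarith
  qed (use d1 d2 in simp)
qed

section \<open>Continuous replacements for the jump at 1/2\<close>

text \<open>A step function made continuous with slope \<open>n\<close>. For \<open>c = 1\<close> it
  is 1 from 0 on and the transition lies left of 0; for \<open>c = 0\<close> it vanishes up to 0 and
  the transition lies right of it.\<close>

definition ramp :: "real \<Rightarrow> nat \<Rightarrow> real \<Rightarrow> real" where
  "ramp c n y = max 0 (min 1 (c + real n * y))"

lemma ramp_bounds: "0 \<le> ramp c n y" "ramp c n y \<le> 1"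
  by (simp_all add: ramp_def)

lemma ramp_limit:
  assumes "c \<in> {0, 1}"
  shows "(\<lambda>n. ramp c n y) \<longlonglongrightarrow> (if y = 0 then c else if y > 0 then 1 else 0)"
proof -
  consider "y = 0" | "y > 0" | "y < 0" by linarith
  then show ?thesis
  proof cases
    case 1
    with assms show ?thesis
      by (auto simp: ramp_def)
  next
    case 2
    obtain m where m: "1 < real m * y"
      using reals_Archimedean3[OF 2] by blast
    have "ramp c n y = 1" if "n \<ge> m" for n
    proof -
      have "real m * y \<le> real n * y"
        using that 2 by (intro mult_right_mono) auto
      with m assms show ?thesis
        by (auto simp: ramp_def)
    qed
    with 2 show ?thesis
      by (auto intro!: tendsto_eventually eventually_sequentiallyI[of m])
  next
    case 3
    then have "0 < - y" by simp
    from reals_Archimedean3[OF this] obtain m where m: "1 < real m * (- y)"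
      by blast
    have "ramp c n y = 0" if "n \<ge> m" for n
    proof -
      have "real m * (- y) \<le> real n * (- y)"
        using that 3 by (intro mult_right_mono) auto
      with m assms show ?thesis
        by (auto simp: ramp_def)
    qed
    with 3 show ?thesis
      by (auto intro!: tendsto_eventually eventually_sequentiallyI[of m])
  qed
qed

text \<open>As \<open>n\<close> grows this approaches \<open>h (2 * x) / 4\<close> left of \<open>1 / 2\<close> and \<open>h (2 * x - 1) + (1 - x)\<^sup>2\<close> right
  of it. For \<open>c = 1\<close> the transition layers overlap, so upper bounds of the limit function stay
  upper bounds; for \<open>c = 0\<close> they leave a gap, so lower bounds stay lower bounds.\<close>

definition blend :: "real \<Rightarrow> nat \<Rightarrow> (real \<Rightarrow> real) \<Rightarrow> real \<Rightarrow> real" where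
  "blend c n h x = ramp c n (1 / 2 - x) * (h (2 * x) / 4) +
     ramp c n (x - 1 / 2) * (h (2 * x - 1) + (1 - x) ^ 2)"

lemma continuous_on_blend:
  assumes "continuous_on UNIV h"
  shows "continuous_on UNIV (blend c n h)"
  unfolding blend_def ramp_def
  by (intro continuous_intros continuous_on_compose2[OF assms]) auto

lemma blend_nonneg: "(\<And>x. 0 \<le> h x) \<Longrightarrow> 0 \<le> blend c n h x"
  by (simp add: blend_def ramp_bounds)

text \<open>The ramps lie between 0 and 1, so the sum of both branches dominates, and the value of
  the limit at the single point 1/2 is irrelevant. The coefficient 5/8 is 1/8 from the left branch
  plus 1/2 from the right one.\<close>

lemma integral_blend_tendsto:
  assumes c: "c \<in> {0, 1}" and h: "continuous_on UNIV h" and h0: "\<And>x. 0 \<le> h x"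
  shows "(\<lambda>n. integral {0..1} (blend c n h)) \<longlonglongrightarrow> 5 / 8 * integral {0..1} h + 1 / 24"
proof -
  let ?A = "\<lambda>x. h (2 * x) / 4"
  let ?B = "\<lambda>x. h (2 * x - 1) + (1 - x) ^ 2"
  let ?G = "\<lambda>x. (if 1 / 2 - x = 0 then c else if 1 / 2 - x > 0 then 1 else 0) * ?A x +
      (if x - 1 / 2 = 0 then c else if x - 1 / 2 > 0 then 1 else 0) * ?B x"
  let ?J = "integral {0..1} h"
  have contA: "continuous_on UNIV ?A" and contB: "continuous_on UNIV ?B"
    by (intro continuous_intros continuous_on_compose2[OF h]; simp)+
  have J: "(h has_integral ?J) {0..1}"
    by (intro integrable_integral integrable_continuous_real continuous_on_subset[OF h]) simp
  have lim: "(\<lambda>n. integral {0..1} (blend c n h)) \<longlonglongrightarrow> integral {0..1} ?G"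
  proof (rule dominated_convergence(2))
    show "blend c n h integrable_on {0..1}" for n
      by (intro integrable_continuous_real continuous_on_subset[OF continuous_on_blend[OF h]]) simp
    show "(\<lambda>x. ?A x + ?B x) integrable_on {0..1}"
      by (intro integrable_continuous_real continuous_intros
          continuous_on_subset[OF contA] continuous_on_subset[OF contB]) simp_all
    show "norm (blend c n h x) \<le> ?A x + ?B x" for n x
      unfolding real_norm_def abs_of_nonneg[OF blend_nonneg[OF h0]]
      unfolding blend_def
      by (intro add_mono mult_left_le_one_le) (simp_all add: ramp_bounds h0)
    show "(\<lambda>n. blend c n h x) \<longlonglongrightarrow> ?G x" for x
      unfolding blend_def by (intro tendsto_intros ramp_limit[OF c])
  qed
  have "(?A has_integral (1 / 8) * ?J) {0..1 / 2}"
    using has_integral_mult_right[OF has_integral_stretch_real[OF J, of 2], of "1 / 4"] by simp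
  then have left: "(?G has_integral (1 / 8) * ?J) {0..1 / 2}"
    by (rule has_integral_spike_finite[where S = "{1 / 2}", rotated 2]) auto
  have affine: "((\<lambda>x. h (2 * x - 1)) has_integral (1 / 2) * ?J) {1 / 2..1}"
    using has_integral_affinity[of h ?J 0 1 2 "- 1"] J
      image_affinity_atLeastAtMost[of "1 / 2" "1 / 2" 0 "1 :: real"] by simp
  have square: "((\<lambda>x. (1 - x) ^ 2) has_integral 1 / 24) {1 / 2..1 :: real}"
  proof -
    have "((\<lambda>x. (1 - x) ^ 2) has_integral (- ((1 - 1) ^ 3) / 3 - - ((1 - 1 / 2) ^ 3) / 3)) {1 / 2..1 :: real}"
    proof (intro fundamental_theorem_of_calculus)
      fix x :: real
      have "((\<lambda>x. - ((1 - x) ^ 3) / 3) has_real_derivative (1 - x) ^ 2) (at x within {1 / 2..1})"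
        by (auto intro!: derivative_eq_intros)
      then show "((\<lambda>x. - ((1 - x) ^ 3) / 3) has_vector_derivative (1 - x) ^ 2) (at x within {1 / 2..1})"
        by (simp add: has_real_derivative_iff_has_vector_derivative)
    qed simp
    then show ?thesis
      by (simp add: power3_eq_cube)
  qed
  have right: "(?G has_integral (1 / 2) * ?J + 1 / 24) {1 / 2..1}"
    by (rule has_integral_spike_finite[OF _ _ has_integral_add[OF affine square], where S = "{1 / 2}"]) auto
  have "(?G has_integral ((1 / 8) * ?J + ((1 / 2) * ?J + 1 / 24))) {0..1}"
    by (rule has_integral_combine[OF _ _ left right]) auto
  then have "integral {0..1} ?G = 5 / 8 * ?J + 1 / 24"
    by (simp add: integral_unique)
  with lim show ?thesis
    by simp
qed

text \<open>The integral map \<open>J \<mapsto> 5 / 8 * J + 1 / 24\<close> contracts to its fixed point \<open>1 / 9\<close>; the rate \<open>3 / 4\<close>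
  leaves room for the error of the transition layers.\<close>

lemma iterated_blend:
  fixes P :: "(real \<Rightarrow> real) \<Rightarrow> bool"
  assumes c: "c \<in> {0, 1}" and base: "P (\<lambda>_. c)"
    and step: "\<And>h n. (\<And>x. 0 \<le> h x) \<Longrightarrow> P h \<Longrightarrow> P (blend c n h)"
  shows "\<exists>h. continuous_on UNIV h \<and> (\<forall>x. 0 \<le> h x) \<and> P h \<and>
    \<bar>integral {0..1} h - 1 / 9\<bar> \<le> (3 / 4) ^ k"
proof (induction k)
  case 0
  show ?case
    using c base by (intro exI[of _ "\<lambda>_. c"]) auto
next
  case (Suc k)
  then obtain h where h: "continuous_on UNIV h" "\<And>x. 0 \<le> h x" "P h"
    and J: "\<bar>integral {0..1} h - 1 / 9\<bar> \<le> (3 / 4) ^ k"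
    by blast
  have "(\<lambda>n. \<bar>integral {0..1} (blend c n h) - 1 / 9\<bar>)
      \<longlonglongrightarrow> \<bar>5 / 8 * integral {0..1} h + 1 / 24 - 1 / 9\<bar>"
    by (intro tendsto_intros integral_blend_tendsto[OF c h(1,2)])
  moreover have "\<bar>5 / 8 * integral {0..1} h + 1 / 24 - 1 / 9\<bar> < (3 / 4) ^ Suc k"
  proof -
    have "\<bar>5 / 8 * integral {0..1} h + 1 / 24 - 1 / 9\<bar> = 5 / 8 * \<bar>integral {0..1} h - 1 / 9\<bar>"
      by (simp add: abs_if)
    also have "\<dots> \<le> 5 / 8 * (3 / 4) ^ k"
      using J by simp
    also have "\<dots> < (3 / 4) ^ Suc k"
      by simp
    finally show ?thesis .
  qed
  ultimately have "eventually (\<lambda>n. \<bar>integral {0..1} (blend c n h) - 1 / 9\<bar> < (3 / 4) ^ Suc k) sequentially"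
    by (rule order_tendstoD)
  then obtain n where "\<bar>integral {0..1} (blend c n h) - 1 / 9\<bar> < (3 / 4) ^ Suc k"
    by (auto simp: eventually_sequentially)
  then show ?case
    using h step by (intro exI[of _ "blend c n h"] conjI)
      (auto intro: continuous_on_blend blend_nonneg)
qed

text \<open>Upper bounds come from \<open>iterated_blend\<close> with \<open>c = 1\<close>, lower
  bounds with \<open>c = 0\<close>. By the functional equation \<open>blend\<close> preserves the
  bound for every \<open>n\<close>, which leaves \<open>n\<close> free to bring the integral close
  to its limit.\<close>

lemma self_similar_has_riemann_integral:
  assumes bounds: "\<And>x. x \<in> {0..1} \<Longrightarrow> 0 \<le> F x \<and> F x \<le> 1"
    and left: "\<And>x. 0 \<le> x \<Longrightarrow> x < 1 / 2 \<Longrightarrow> F x = F (2 * x) / 4"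
    and right: "\<And>x. 1 / 2 \<le> x \<Longrightarrow> x \<le> 1 \<Longrightarrow> F x = F (2 * x - 1) + (1 - x) ^ 2"
  shows "has_riemann_integral F 0 1 (1 / 9)"
proof (rule has_riemann_integral_squeeze)
  fix e :: real
  assume "e > 0"
  then obtain k where k: "(3 / 4) ^ k < e"
    using real_arch_pow_inv[of e "3 / 4"] by auto
  have "\<exists>h. continuous_on UNIV h \<and> (\<forall>x. 0 \<le> h x) \<and> (\<forall>x\<in>{0..1}. F x \<le> h x) \<and>
      \<bar>integral {0..1} h - 1 / 9\<bar> \<le> (3 / 4) ^ k"
  proof (rule iterated_blend)
    fix h :: "real \<Rightarrow> real" and n
    assume h0: "\<And>x. 0 \<le> h x" and h: "\<forall>x\<in>{0..1}. F x \<le> h x"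
    show "\<forall>x\<in>{0..1}. F x \<le> blend 1 n h x"
    proof
      fix x :: real
      assume x: "x \<in> {0..1}"
      show "F x \<le> blend 1 n h x"
      proof (cases "x < 1 / 2")
        case True
        then have "ramp 1 n (1 / 2 - x) = 1"
          by (simp add: ramp_def)
        moreover have "F x \<le> h (2 * x) / 4"
          using h x True left[of x] by simp
        \<comment> \<open>Here \<open>2 * x - 1\<close> is negative, where \<open>h\<close> bounds
          nothing; its nonnegativity on the whole line suffices.\<close>
        moreover have "0 \<le> ramp 1 n (x - 1 / 2) * (h (2 * x - 1) + (1 - x) ^ 2)"
          by (simp add: ramp_bounds h0)
        ultimately show ?thesis
          by (simp add: blend_def)
      next
        case False
        then have "ramp 1 n (x - 1 / 2) = 1"
          by (simp add: ramp_def)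
        moreover have "F x \<le> h (2 * x - 1) + (1 - x) ^ 2"
          using h x False right[of x] by simp
        moreover have "0 \<le> ramp 1 n (1 / 2 - x) * (h (2 * x) / 4)"
          by (simp add: ramp_bounds h0)
        ultimately show ?thesis
          by (simp add: blend_def)
      qed
    qed
  qed (use bounds in auto)
  then obtain h where h: "continuous_on UNIV h" "\<forall>x\<in>{0..1}. F x \<le> h x"
    "\<bar>integral {0..1} h - 1 / 9\<bar> \<le> (3 / 4) ^ k"
    by blast
  have "\<exists>g. continuous_on UNIV g \<and> (\<forall>x. 0 \<le> g x) \<and> (\<forall>x\<in>{0..1}. g x \<le> F x) \<and>
      \<bar>integral {0..1} g - 1 / 9\<bar> \<le> (3 / 4) ^ k"
  proof (rule iterated_blend)
    fix g :: "real \<Rightarrow> real" and n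
    assume g0: "\<And>x. 0 \<le> g x" and g: "\<forall>x\<in>{0..1}. g x \<le> F x"
    show "\<forall>x\<in>{0..1}. blend 0 n g x \<le> F x"
    proof
      fix x :: real
      assume x: "x \<in> {0..1}"
      show "blend 0 n g x \<le> F x"
      proof (cases "x < 1 / 2")
        case True
        \<comment> \<open>For a lower bound the branch of the wrong half must vanish; the other ramp
          only shrinks a nonnegative value.\<close>
        then have "real n * (x - 1 / 2) \<le> 0"
          by (simp add: mult_nonneg_nonpos)
        then have "ramp 0 n (x - 1 / 2) = 0"
          by (simp add: ramp_def)
        moreover have "g (2 * x) / 4 \<le> F x"
          using g x True left[of x] by simp
        moreover have "ramp 0 n (1 / 2 - x) * (g (2 * x) / 4) \<le> g (2 * x) / 4"
          by (intro mult_left_le_one_le) (simp_all add: ramp_bounds g0)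
        ultimately show ?thesis
          by (simp add: blend_def)
      next
        case False
        then have "real n * (1 / 2 - x) \<le> 0"
          by (simp add: mult_nonneg_nonpos)
        then have "ramp 0 n (1 / 2 - x) = 0"
          by (simp add: ramp_def)
        moreover have "g (2 * x - 1) + (1 - x) ^ 2 \<le> F x"
          using g x False right[of x] by simp
        moreover have "ramp 0 n (x - 1 / 2) * (g (2 * x - 1) + (1 - x) ^ 2) \<le> g (2 * x - 1) + (1 - x) ^ 2"
          by (intro mult_left_le_one_le) (simp_all add: ramp_bounds g0)
        ultimately show ?thesis
          by (simp add: blend_def)
      qed
    qed
  qed (use bounds in auto)
  then obtain g where g: "continuous_on UNIV g" "\<forall>x\<in>{0..1}. g x \<le> F x"
    "\<bar>integral {0..1} g - 1 / 9\<bar> \<le> (3 / 4) ^ k"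
    by blast
  show "\<exists>g h Ig Ih. has_riemann_integral g 0 1 Ig \<and> has_riemann_integral h 0 1 Ih \<and>
      (\<forall>x\<in>{0..1}. g x \<le> F x \<and> F x \<le> h x) \<and> 1 / 9 - e < Ig \<and> Ih < 1 / 9 + e"
    using g h k
    by (intro exI[of _ g] exI[of _ h] exI[of _ "integral {0..1} g"] exI[of _ "integral {0..1} h"] conjI)
      (auto intro!: has_riemann_integral_continuous intro: continuous_on_subset)
qed

lemma doubling_count_num: "rule_a f \<Longrightarrow> doubling_count (num f)"
  by unfold_locales (simp add: num_def, rule num_power2_add)

theorem theorem2:
  fixes f :: local_rule
  assumes "symmetrical f" and "rule_a f"
  shows "riemann_integrable (limit_function f) 0 1 \<and>
         riemann_integral (limit_function f) 0 1 = 1 / 9"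
proof -
  have dc: "doubling_count (num f)"
    by (rule doubling_count_num[OF assms(2)])
  interpret doubling_count "num f"
    by (rule dc)
  note eq = limit_function_eq[OF dc]
  have "has_riemann_integral (limit_function f) 0 1 (1 / 9)"
  proof (rule self_similar_has_riemann_integral)
    show "0 \<le> limit_function f x \<and> limit_function f x \<le> 1" if "x \<in> {0..1}" for x
      unfolding eq[OF that] using lim_scaled_bounds[OF that] by blast
    show "limit_function f x = limit_function f (2 * x) / 4" if "0 \<le> x" "x < 1 / 2" for x
      using lim_scaled_left[OF that] that by (simp add: eq)
    show "limit_function f x = limit_function f (2 * x - 1) + (1 - x) ^ 2" if "1 / 2 \<le> x" "x \<le> 1" for x
      using lim_scaled_right[OF that] that by (simp add: eq)
  qed
  then show ?thesis
    using riemann_integral_eqI by (auto simp: riemann_integrable_def)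
qed

end
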